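(* For every $\Gamma\cup\{\varphi\}\subseteq For(\Sigma)$: if $\Gamma\models_{\mathbb{NM}}\varphi$ then $\Gamma\vdash_{\mathbf{RmbC}}\varphi$.
   Context: Let $\Sigma=\{\wedge,\vee,\to,\neg,\circ\}$ ($\neg,\circ$ unary, the others binary) and let $For(\Sigma)$ be the set of formulas over $\Sigma$ generated by a denumerable set $\mathcal V$ of propositional variables. $\alpha\leftrightarrow\beta$ abbreviates $(\alpha\to\beta)\wedge(\beta\to\alpha)$. $\mathbf{RmbC}$ is the Hilbert calculus with axiom schemas: (Ax1) $\alpha\to(\beta\to\alpha)$; (Ax2) $(\alpha\to(\beta\to\gamma))\to((\alpha\to\beta)\to(\alpha\to\gamma))$; (Ax3) $\alpha\to(\beta\to(\alpha\wedge\beta))$; (Ax4) $(\alpha\wedge\beta)\to\alpha$; (Ax5) $(\alpha\wedge\beta)\to\beta$; (Ax6) $\alpha\to(\alpha\vee\beta)$; (Ax7) $\beta\to(\alpha\vee\beta)$; (Ax8) $(\alpha\to\gamma)\to((\beta\to\gamma)\to((\alpha\vee\beta)\to\gamma))$; (Ax9) $(\alpha\to\beta)\vee\alpha$; (Ax10) $\alpha\vee\neg\alpha$; (bc1) $\circ\alpha\to(\alpha\to(\neg\alpha\to\beta))$; and rules: (MP) from $\alpha$ and $\alpha\to\beta$ infer $\beta$; $(\mathbf R_\neg)$ from $\alpha\leftrightarrow\beta$ infer $\neg\alpha\leftrightarrow\neg\beta$; $(\mathbf R_\circ)$ from $\alpha\leftrightarrow\beta$ infer $\circ\alpha\leftrightarrow\circ\beta$.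 A formula $\varphi$ is a theorem ($\vdash_{\mathbf{RmbC}}\varphi$) if there is a finite sequence of formulas ending in $\varphi$ each of which is an instance of an axiom schema or follows from earlier formulas of the sequence by a rule. $\Gamma\vdash_{\mathbf{RmbC}}\varphi$ means that either $\vdash_{\mathbf{RmbC}}\varphi$ or there is a finite non-empty $\{\gamma_1,\dots,\gamma_n\}\subseteq\Gamma$ with $\vdash_{\mathbf{RmbC}}(\gamma_1\wedge(\gamma_2\wedge(\cdots\wedge(\gamma_{n-1}\wedge\gamma_n)\cdots)))\to\varphi$. A neighborhood frame for $\mathbf{RmbC}$ is a triple $\mathcal F=\langle W,S_\neg,S_\circ\rangle$ with $W$ a non-empty set and $S_\neg,S_\circ:\wp(W)\to\wp(W)$ arbitrary functions. A neighborhood model is $\mathcal M=\langle\mathcal F,d\rangle$ with $d:\mathcal V\to\wp(W)$. The denotation $[\![\cdot]\!]_{\mathcal M}:For(\Sigma)\to\wp(W)$ is defined by: $[\![p]\!]=d(p)$; $[\![\varphi\wedge\psi]\!]=[\![\varphi]\!]\cap[\![\psi]\!]$; $[\![\varphi\vee\psi]\!]=[\![\varphi]\!]\cup[\![\psi]\!]$; $[\![\varphi\to\psi]\!]=(W\setminus[\![\varphi]\!])\cup[\![\psi]\!]$; $[\![\neg\varphi]\!]=(W\setminus[\![\varphi]\!])\cup S_\neg([\![\varphi]\!])$; $[\![\circ\varphi]\!]=(W\setminus([\![\varphi]\!]\cap S_\neg([\![\varphi]\!])))\cap S_\circ([\![\varphi]\!])$. $\models_{\mathbb{NM}}\varphi$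 means $[\![\varphi]\!]_{\mathcal M}=W$ for every neighborhood model $\mathcal M$. $\Gamma\models_{\mathbb{NM}}\varphi$ means that either $\models_{\mathbb{NM}}\varphi$ or there is a finite non-empty $\{\gamma_1,\dots,\gamma_n\}\subseteq\Gamma$ with $\models_{\mathbb{NM}}(\gamma_1\wedge\cdots\wedge\gamma_n)\to\varphi$. *)

theory Defs
  imports Main "HOL-Library.FuncSet" "HOL-Library.Infinite_Typeclass"
begin

datatype fm =
    Var nat
  | And fm fm  (infixr \<open>\<^bold>\<and>\<close> 65)
  | Or fm fm   (infixr \<open>\<^bold>\<or>\<close> 60)
  | Imp fm fm  (infixr \<open>\<^bold>\<rightarrow>\<close> 55)
  | Neg fm     (\<open>\<^bold>\<not> _\<close> [70] 70)
  | Circ fm    (\<open>\<^bold>\<circ> _\<close> [70] 70)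

abbreviation Iff :: "fm \<Rightarrow> fm \<Rightarrow> fm" (infix \<open>\<^bold>\<leftrightarrow>\<close> 50) where
  "\<alpha> \<^bold>\<leftrightarrow> \<beta> \<equiv> (\<alpha> \<^bold>\<rightarrow> \<beta>) \<^bold>\<and> (\<beta> \<^bold>\<rightarrow> \<alpha>)"

text \<open>Right-nested conjunction of a non-empty list; the value at the empty list is irrelevant.\<close>

fun big_and :: "fm list \<Rightarrow> fm" where
  "big_and [] = undefined"
| "big_and [\<gamma>] = \<gamma>"
| "big_and (\<gamma> # \<gamma>' # \<gamma>s) = \<gamma> \<^bold>\<and> big_and (\<gamma>' # \<gamma>s)"

inductive RmbC_axiom :: "fm \<Rightarrow> bool" where
  Ax1: "RmbC_axiom (\<alpha> \<^bold>\<rightarrow> (\<beta> \<^bold>\<rightarrow> \<alpha>))"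
| Ax2: "RmbC_axiom ((\<alpha> \<^bold>\<rightarrow> (\<beta> \<^bold>\<rightarrow> \<gamma>)) \<^bold>\<rightarrow> ((\<alpha> \<^bold>\<rightarrow> \<beta>) \<^bold>\<rightarrow> (\<alpha> \<^bold>\<rightarrow> \<gamma>)))"
| Ax3: "RmbC_axiom (\<alpha> \<^bold>\<rightarrow> (\<beta> \<^bold>\<rightarrow> (\<alpha> \<^bold>\<and> \<beta>)))"
| Ax4: "RmbC_axiom ((\<alpha> \<^bold>\<and> \<beta>) \<^bold>\<rightarrow> \<alpha>)"
| Ax5: "RmbC_axiom ((\<alpha> \<^bold>\<and> \<beta>) \<^bold>\<rightarrow> \<beta>)"
| Ax6: "RmbC_axiom (\<alpha> \<^bold>\<rightarrow> (\<alpha> \<^bold>\<or> \<beta>))"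
| Ax7: "RmbC_axiom (\<beta> \<^bold>\<rightarrow> (\<alpha> \<^bold>\<or> \<beta>))"
| Ax8: "RmbC_axiom ((\<alpha> \<^bold>\<rightarrow> \<gamma>) \<^bold>\<rightarrow> ((\<beta> \<^bold>\<rightarrow> \<gamma>) \<^bold>\<rightarrow> ((\<alpha> \<^bold>\<or> \<beta>) \<^bold>\<rightarrow> \<gamma>)))"
| Ax9: "RmbC_axiom ((\<alpha> \<^bold>\<rightarrow> \<beta>) \<^bold>\<or> \<alpha>)"
| Ax10: "RmbC_axiom (\<alpha> \<^bold>\<or> (\<^bold>\<not> \<alpha>))"
| bc1: "RmbC_axiom ((\<^bold>\<circ> \<alpha>) \<^bold>\<rightarrow> (\<alpha> \<^bold>\<rightarrow> ((\<^bold>\<not> \<alpha>) \<^bold>\<rightarrow> \<beta>)))"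

text \<open>\<open>RmbC_rule A \<phi>\<close>: the formula \<open>\<phi>\<close> follows by one rule from premises in \<open>A\<close>.\<close>

inductive RmbC_rule :: "fm set \<Rightarrow> fm \<Rightarrow> bool" for A :: "fm set" where
  MP: "\<alpha> \<in> A \<Longrightarrow> (\<alpha> \<^bold>\<rightarrow> \<beta>) \<in> A \<Longrightarrow> RmbC_rule A \<beta>"
| R_neg: "(\<alpha> \<^bold>\<leftrightarrow> \<beta>) \<in> A \<Longrightarrow> RmbC_rule A ((\<^bold>\<not> \<alpha>) \<^bold>\<leftrightarrow> (\<^bold>\<not> \<beta>))"
| R_circ: "(\<alpha> \<^bold>\<leftrightarrow> \<beta>) \<in> A \<Longrightarrow> RmbC_rule A ((\<^bold>\<circ> \<alpha>) \<^bold>\<leftrightarrow> (\<^bold>\<circ> \<beta>))"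

definition RmbC_derivation :: "fm list \<Rightarrow> bool" where
  "RmbC_derivation ds \<longleftrightarrow>
     (\<forall>k < length ds. RmbC_axiom (ds ! k) \<or> RmbC_rule (set (take k ds)) (ds ! k))"

definition RmbC_theorem :: "fm \<Rightarrow> bool" where
  "RmbC_theorem \<phi> \<longleftrightarrow> (\<exists>ds. ds \<noteq> [] \<and> RmbC_derivation ds \<and> last ds = \<phi>)"

text \<open>
  The rules \<open>R_neg\<close> and \<open>R_circ\<close> are never applied to the premises \<open>\<Gamma>\<close>: derivability from
  premises is reduced to theoremhood of an implication.
\<close>

definition RmbC_derives :: "fm set \<Rightarrow> fm \<Rightarrow> bool" where
  "RmbC_derives \<Gamma> \<phi> \<longleftrightarrow>
     RmbC_theorem \<phi> \<or>
     (\<exists>\<gamma>s. \<gamma>s \<noteq> [] \<and> set \<gamma>s \<subseteq> \<Gamma> \<and> RmbC_theorem (big_and \<gamma>s \<^bold>\<rightarrow> \<phi>))"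

record 'w nframe =
  worlds :: "'w set"
  S_neg :: "'w set \<Rightarrow> 'w set"
  S_circ :: "'w set \<Rightarrow> 'w set"

record 'w nmodel = "'w nframe" +
  val :: "nat \<Rightarrow> 'w set"

definition nframe :: "('w, 'z) nframe_scheme \<Rightarrow> bool" where
  "nframe F \<longleftrightarrow>
     worlds F \<noteq> {} \<and>
     S_neg F \<in> Pow (worlds F) \<rightarrow> Pow (worlds F) \<and>
     S_circ F \<in> Pow (worlds F) \<rightarrow> Pow (worlds F)"

definition nmodel :: "'w nmodel \<Rightarrow> bool" where
  "nmodel M \<longleftrightarrow> nframe M \<and> (\<forall>p. val M p \<subseteq> worlds M)"

primrec den :: "'w nmodel \<Rightarrow> fm \<Rightarrow> 'w set" where
  "den M (Var p) = val M p"
| "den M (\<phi> \<^bold>\<and> \<psi>) = den M \<phi> \<inter> den M \<psi>"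
| "den M (\<phi> \<^bold>\<or> \<psi>) = den M \<phi> \<union> den M \<psi>"
| "den M (\<phi> \<^bold>\<rightarrow> \<psi>) = (worlds M - den M \<phi>) \<union> den M \<psi>"
| "den M (\<^bold>\<not> \<phi>) = (worlds M - den M \<phi>) \<union> S_neg M (den M \<phi>)"
| "den M (\<^bold>\<circ> \<phi>) =
     (worlds M - (den M \<phi> \<inter> S_neg M (den M \<phi>))) \<inter> S_circ M (den M \<phi>)"

text \<open>
  HOL cannot quantify over all types inside a formula, so validity and consequence take the type
  \<open>'w\<close> from which sets of worlds are drawn as a parameter; \<open>worlds M\<close> ranges over all
  non-empty subsets of that type.  They are meant for infinite \<open>'w\<close>: a finite \<open>'w\<close> bounds the
  size of the models, and then more formulas are valid (over a one-element type, for instance,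
  \<open>(p \<^bold>\<leftrightarrow> q) \<^bold>\<rightarrow> ((\<^bold>\<not> p) \<^bold>\<leftrightarrow> (\<^bold>\<not> q))\<close>).
\<close>

definition NM_valid :: "'w itself \<Rightarrow> fm \<Rightarrow> bool" where
  "NM_valid TYPE('w) \<phi> \<longleftrightarrow> (\<forall>M :: 'w nmodel. nmodel M \<longrightarrow> den M \<phi> = worlds M)"

definition NM_entails :: "'w itself \<Rightarrow> fm set \<Rightarrow> fm \<Rightarrow> bool" where
  "NM_entails TYPE('w) \<Gamma> \<phi> \<longleftrightarrow>
     NM_valid TYPE('w) \<phi> \<or>
     (\<exists>\<gamma>s. \<gamma>s \<noteq> [] \<and> set \<gamma>s \<subseteq> \<Gamma> \<and> NM_valid TYPE('w) (big_and \<gamma>s \<^bold>\<rightarrow> \<phi>))"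

end

theory Submission
  imports Defs "HOL-Library.Countable"
begin

text \<open>
  Completeness by a canonical model that is countable, so that it embeds into any infinite type.
  The set of all saturated theories would be uncountable; instead the worlds are the non-theorems
  \<open>\<psi>\<close>, each carrying one chosen theory maximal among those omitting \<open>\<psi>\<close>.  These already
  separate non-theorems from theorems, so \<open>\<alpha>\<close> and \<open>\<beta>\<close> hold at the same worlds
  only if \<open>\<alpha> \<leftrightarrow> \<beta>\<close> is a theorem, and the replacement rules make the neighbourhood
  functions well defined on truth sets.
\<close>

section \<open>Closure of theoremhood under the axioms and rules\<close>

lemma RmbC_rule_mono: "RmbC_rule A \<phi> \<Longrightarrow> A \<subseteq> B \<Longrightarrow> RmbC_rule B \<phi>"
  by (induction rule: RmbC_rule.induct) (auto intro: RmbC_rule.intros)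

text \<open>Lines of \<open>es\<close> only gain earlier formulas, and rules are monotone in their
  premises. This joins the derivations of the two premises of modus ponens.\<close>

lemma RmbC_derivation_append:
  assumes "RmbC_derivation ds" "RmbC_derivation es"
  shows "RmbC_derivation (ds @ es)"
  unfolding RmbC_derivation_def
proof (intro allI impI)
  fix k assume k: "k < length (ds @ es)"
  show "RmbC_axiom ((ds @ es) ! k) \<or> RmbC_rule (set (take k (ds @ es))) ((ds @ es) ! k)"
  proof (cases "k < length ds")
    case True
    then show ?thesis
      using assms(1) by (auto simp: RmbC_derivation_def nth_append)
  next
    case False
    then have "RmbC_axiom (es ! (k - length ds)) \<or>
        RmbC_rule (set (take (k - length ds) es)) (es ! (k - length ds))"
      using assms(2) k by (auto simp: RmbC_derivation_def)
    then show ?thesis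
      using False by (auto simp: nth_append intro: RmbC_rule_mono)
  qed
qed

lemma RmbC_derivation_snoc:
  assumes "RmbC_derivation ds" "RmbC_axiom \<phi> \<or> RmbC_rule (set ds) \<phi>"
  shows "RmbC_derivation (ds @ [\<phi>])"
  using assms by (auto simp: RmbC_derivation_def nth_append less_Suc_eq)

lemma RmbC_theorem_snoc:
  assumes "RmbC_derivation ds" "RmbC_axiom \<phi> \<or> RmbC_rule (set ds) \<phi>"
  shows "RmbC_theorem \<phi>"
  using RmbC_derivation_snoc[OF assms] unfolding RmbC_theorem_def by (metis last_snoc snoc_eq_iff_butlast)

lemma RmbC_theoremE:
  assumes "RmbC_theorem \<phi>"
  obtains ds where "RmbC_derivation ds" "\<phi> \<in> set ds"
  using assms unfolding RmbC_theorem_def by (metis last_in_set)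

lemma theorem_axiom: "RmbC_axiom \<phi> \<Longrightarrow> RmbC_theorem \<phi>"
  by (rule RmbC_theorem_snoc[of "[]"]) (auto simp: RmbC_derivation_def)

lemma theorem_MP:
  assumes "RmbC_theorem \<alpha>" "RmbC_theorem (\<alpha> \<^bold>\<rightarrow> \<beta>)"
  shows "RmbC_theorem \<beta>"
proof -
  obtain ds es where "RmbC_derivation ds" "\<alpha> \<in> set ds"
    and "RmbC_derivation es" "(\<alpha> \<^bold>\<rightarrow> \<beta>) \<in> set es"
    using assms by (metis RmbC_theoremE)
  then show ?thesis
    by (intro RmbC_theorem_snoc[of "ds @ es"] RmbC_derivation_append disjI2 RmbC_rule.MP[of \<alpha>]) auto
qed

lemma theorem_R_neg: "RmbC_theorem (\<alpha> \<^bold>\<leftrightarrow> \<beta>) \<Longrightarrow> RmbC_theorem ((\<^bold>\<not> \<alpha>) \<^bold>\<leftrightarrow> (\<^bold>\<not> \<beta>))"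
  by (elim RmbC_theoremE) (blast intro: RmbC_theorem_snoc RmbC_rule.R_neg)

lemma theorem_R_circ: "RmbC_theorem (\<alpha> \<^bold>\<leftrightarrow> \<beta>) \<Longrightarrow> RmbC_theorem ((\<^bold>\<circ> \<alpha>) \<^bold>\<leftrightarrow> (\<^bold>\<circ> \<beta>))"
  by (elim RmbC_theoremE) (blast intro: RmbC_theorem_snoc RmbC_rule.R_circ)

section \<open>Theories and their saturated extensions\<close>

text \<open>Closure is under modus ponens only: the replacement rules act on theorems, so a theory
  may contain a biconditional without the one between the negations.\<close>

definition is_theory :: "fm set \<Rightarrow> bool" where
  "is_theory T \<longleftrightarrow>
     (\<forall>\<alpha>. RmbC_theorem \<alpha> \<longrightarrow> \<alpha> \<in> T) \<and> (\<forall>\<alpha> \<beta>. \<alpha> \<in> T \<longrightarrow> (\<alpha> \<^bold>\<rightarrow> \<beta>) \<in> T \<longrightarrow> \<beta> \<in> T)"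

lemma is_theory_MP: "is_theory T \<Longrightarrow> (\<alpha> \<^bold>\<rightarrow> \<beta>) \<in> T \<Longrightarrow> \<alpha> \<in> T \<Longrightarrow> \<beta> \<in> T"
  unfolding is_theory_def by blast

lemma is_theory_axiom: "is_theory T \<Longrightarrow> RmbC_axiom \<alpha> \<Longrightarrow> \<alpha> \<in> T"
  unfolding is_theory_def using theorem_axiom by blast

lemma is_theory_theorems: "is_theory {\<alpha>. RmbC_theorem \<alpha>}"
  unfolding is_theory_def using theorem_MP by blast

text \<open>The two premises of a modus ponens both lie in the larger of the two members that
  contain them.\<close>

lemma is_theory_Union_chain:
  assumes "\<C> \<noteq> {}" "\<And>T. T \<in> \<C> \<Longrightarrow> is_theory T"
    and "\<And>S T. S \<in> \<C> \<Longrightarrow> T \<in> \<C> \<Longrightarrow> S \<subseteq> T \<or> T \<subseteq> S"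
  shows "is_theory (\<Union>\<C>)"
  unfolding is_theory_def
proof (intro conjI allI impI)
  show "\<alpha> \<in> \<Union>\<C>" if "RmbC_theorem \<alpha>" for \<alpha>
    using that assms(1,2) unfolding is_theory_def by blast
  show "\<beta> \<in> \<Union>\<C>" if "\<alpha> \<in> \<Union>\<C>" "(\<alpha> \<^bold>\<rightarrow> \<beta>) \<in> \<Union>\<C>" for \<alpha> \<beta>
  proof -
    from that assms(3) obtain T where "T \<in> \<C>" "\<alpha> \<in> T" "(\<alpha> \<^bold>\<rightarrow> \<beta>) \<in> T"
      by blast
    then show ?thesis
      using assms(2) is_theory_MP by blast
  qed
qed

text \<open>The deduction theorem in semantic dress: this set is the theory generated by
  \<open>T\<close> and \<alpha>. Ax1 and Ax2 do the work.\<close>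

lemma is_theory_extend:
  assumes "is_theory T"
  shows "is_theory {\<beta>. (\<alpha> \<^bold>\<rightarrow> \<beta>) \<in> T}"
  unfolding is_theory_def
proof (intro conjI allI impI; clarify)
  fix \<beta>
  assume "RmbC_theorem \<beta>"
  then show "(\<alpha> \<^bold>\<rightarrow> \<beta>) \<in> T"
    using assms is_theory_MP[OF assms is_theory_axiom[OF assms Ax1]] unfolding is_theory_def by blast
next
  fix \<beta> \<gamma>
  assume "(\<alpha> \<^bold>\<rightarrow> \<beta>) \<in> T" "(\<alpha> \<^bold>\<rightarrow> (\<beta> \<^bold>\<rightarrow> \<gamma>)) \<in> T"
  then show "(\<alpha> \<^bold>\<rightarrow> \<gamma>) \<in> T"
    using is_theory_MP[OF assms] is_theory_axiom[OF assms Ax2] by blast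
qed

lemma theorem_imp_refl: "RmbC_theorem (\<alpha> \<^bold>\<rightarrow> \<alpha>)"
  by (meson Ax1 Ax2 theorem_MP theorem_axiom)

text \<open>The last clause is maximality in usable form: adding any missing \<alpha> would yield
  \<psi>.\<close>

definition saturated :: "fm \<Rightarrow> fm set \<Rightarrow> bool" where
  "saturated \<psi> T \<longleftrightarrow> is_theory T \<and> \<psi> \<notin> T \<and> (\<forall>\<alpha>. \<alpha> \<notin> T \<longrightarrow> (\<alpha> \<^bold>\<rightarrow> \<psi>) \<in> T)"

lemma saturated_exists:
  assumes "\<not> RmbC_theorem \<psi>"
  obtains T where "saturated \<psi> T"
proof -
  let ?A = "{T. is_theory T \<and> \<psi> \<notin> T}"
  have "\<exists>T\<in>?A. \<forall>X\<in>?A. T \<subseteq> X \<longrightarrow> X = T"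
  proof (rule subset_Zorn_nonempty)
    show "?A \<noteq> {}"
      using assms is_theory_theorems by blast
    fix \<C> assume "\<C> \<noteq> {}" "subset.chain ?A \<C>"
    then have "is_theory (\<Union>\<C>)" "\<psi> \<notin> \<Union>\<C>"
      by (auto simp: subset_chain_def intro!: is_theory_Union_chain)
    then show "\<Union>\<C> \<in> ?A"
      by blast
  qed
  then obtain T where T: "is_theory T" "\<psi> \<notin> T"
    and max: "\<And>X. is_theory X \<Longrightarrow> \<psi> \<notin> X \<Longrightarrow> T \<subseteq> X \<Longrightarrow> X = T"
    by blast
  have "(\<alpha> \<^bold>\<rightarrow> \<psi>) \<in> T" if "\<alpha> \<notin> T" for \<alpha>
  proof (rule ccontr)
    \<comment> \<open>Otherwise the theory generated by \<open>T\<close> and \<alpha> still omits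
      \<psi>, so by maximality it equals \<open>T\<close>, although it contains \<alpha>.\<close>
    let ?X = "{\<beta>. (\<alpha> \<^bold>\<rightarrow> \<beta>) \<in> T}"
    assume "(\<alpha> \<^bold>\<rightarrow> \<psi>) \<notin> T"
    moreover have "T \<subseteq> ?X"
      using is_theory_MP[OF T(1) is_theory_axiom[OF T(1) Ax1]] by blast
    ultimately have "?X = T"
      using max is_theory_extend[OF T(1)] by blast
    moreover have "\<alpha> \<in> ?X"
      using theorem_imp_refl T(1) unfolding is_theory_def by blast
    ultimately show False
      using that by blast
  qed
  with T show thesis
    using that unfolding saturated_def by blast
qed

context
  fixes \<psi> T
  assumes sat: "saturated \<psi> T"
begin

lemma saturated_is_theory: "is_theory T"
  using sat unfolding saturated_def by blast

lemmas saturated_MP = is_theory_MP[OF saturated_is_theory]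
lemmas saturated_axiom = is_theory_axiom[OF saturated_is_theory]

lemma saturated_And: "(\<alpha> \<^bold>\<and> \<beta>) \<in> T \<longleftrightarrow> \<alpha> \<in> T \<and> \<beta> \<in> T"
  by (meson Ax3 Ax4 Ax5 saturated_MP saturated_axiom)

lemma saturated_Or: "(\<alpha> \<^bold>\<or> \<beta>) \<in> T \<longleftrightarrow> \<alpha> \<in> T \<or> \<beta> \<in> T"
proof
  assume *: "(\<alpha> \<^bold>\<or> \<beta>) \<in> T"
  show "\<alpha> \<in> T \<or> \<beta> \<in> T"
  proof (rule ccontr)
    assume "\<not> (\<alpha> \<in> T \<or> \<beta> \<in> T)"
    \<comment> \<open>If both disjuncts are missing, each implies \<psi>, and Ax8 brings \<psi> into
      \<open>T\<close>.\<close>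
    then have "(\<alpha> \<^bold>\<rightarrow> \<psi>) \<in> T" "(\<beta> \<^bold>\<rightarrow> \<psi>) \<in> T"
      using sat unfolding saturated_def by blast+
    then have "\<psi> \<in> T"
      using * Ax8 saturated_MP saturated_axiom by meson
    then show False
      using sat unfolding saturated_def by blast
  qed
qed (meson Ax6 Ax7 saturated_MP saturated_axiom)

text \<open>Ax9 puts the implication or \<alpha> into \<open>T\<close>; in the second case \<beta>
  is in \<open>T\<close> too, and Ax1 gives the implication.\<close>

lemma saturated_Imp: "(\<alpha> \<^bold>\<rightarrow> \<beta>) \<in> T \<longleftrightarrow> (\<alpha> \<in> T \<longrightarrow> \<beta> \<in> T)"
  by (meson Ax1 Ax9 saturated_MP saturated_Or saturated_axiom)

lemma saturated_Neg: "\<alpha> \<notin> T \<Longrightarrow> (\<^bold>\<not> \<alpha>) \<in> T"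
  using Ax10 saturated_Or saturated_axiom by blast

lemma saturated_Circ: "(\<^bold>\<circ> \<alpha>) \<in> T \<Longrightarrow> \<alpha> \<in> T \<Longrightarrow> (\<^bold>\<not> \<alpha>) \<notin> T"
  \<comment> \<open>The explosion in bc1 is aimed at the omitted formula \<psi>.\<close>
  using sat saturated_MP saturated_axiom[OF bc1[of \<alpha> \<psi>]] unfolding saturated_def by blast

end

section \<open>The canonical model and the truth lemma\<close>

definition lindenbaum :: "fm \<Rightarrow> fm set" where
  "lindenbaum \<psi> = (SOME T. saturated \<psi> T)"

lemma saturated_lindenbaum: "\<not> RmbC_theorem \<psi> \<Longrightarrow> saturated \<psi> (lindenbaum \<psi>)"
  unfolding lindenbaum_def by (metis saturated_exists someI)

definition truth_set :: "(fm \<Rightarrow> 'w) \<Rightarrow> fm \<Rightarrow> 'w set" where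
  "truth_set g \<alpha> = g ` {\<psi>. \<not> RmbC_theorem \<psi> \<and> \<alpha> \<in> lindenbaum \<psi>}"

text \<open>The unions define the neighbourhood functions without choosing a representative: on a
  truth set all members will turn out equal, and elsewhere the family is empty and the value is the
  empty set.\<close>

definition canonical_model :: "(fm \<Rightarrow> 'w) \<Rightarrow> 'w nmodel" where
  "canonical_model g =
     \<lparr>worlds = g ` {\<psi>. \<not> RmbC_theorem \<psi>},
      S_neg = (\<lambda>U. \<Union>{truth_set g (\<^bold>\<not> \<alpha>) | \<alpha>. U = truth_set g \<alpha>}),
      S_circ = (\<lambda>U. \<Union>{truth_set g (\<^bold>\<circ> \<alpha>) | \<alpha>. U = truth_set g \<alpha>}),
      val = (\<lambda>p. truth_set g (Var p))\<rparr>"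

lemma truth_set_subset_worlds: "truth_set g \<alpha> \<subseteq> worlds (canonical_model g)"
  by (auto simp: truth_set_def canonical_model_def)

lemma nmodel_canonical_model:
  assumes "\<not> RmbC_theorem \<phi>"
  shows "nmodel (canonical_model g)"
proof -
  have "worlds (canonical_model g) \<noteq> {}"
    using assms by (auto simp: canonical_model_def)
  moreover have "S_neg (canonical_model g) U \<subseteq> worlds (canonical_model g)"
    "S_circ (canonical_model g) U \<subseteq> worlds (canonical_model g)" for U
    by (auto simp: canonical_model_def truth_set_def)
  moreover have "val (canonical_model g) p \<subseteq> worlds (canonical_model g)" for p
    using truth_set_subset_worlds[of g "Var p"] by (simp add: canonical_model_def)
  ultimately show ?thesis
    unfolding nmodel_def nframe_def by blast
qed

context
  fixes g :: "fm \<Rightarrow> 'w"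
  assumes inj: "inj g"
begin

lemma truth_set_iff: "g \<psi> \<in> truth_set g \<alpha> \<longleftrightarrow> \<not> RmbC_theorem \<psi> \<and> \<alpha> \<in> lindenbaum \<psi>"
  using inj by (auto simp: truth_set_def inj_def)

lemma truth_set_eq_iff: "truth_set g \<alpha> = truth_set g \<beta> \<longleftrightarrow> RmbC_theorem (\<alpha> \<^bold>\<leftrightarrow> \<beta>)"
proof
  assume eq: "truth_set g \<alpha> = truth_set g \<beta>"
  show "RmbC_theorem (\<alpha> \<^bold>\<leftrightarrow> \<beta>)"
  proof (rule ccontr)
    assume nt: "\<not> RmbC_theorem (\<alpha> \<^bold>\<leftrightarrow> \<beta>)"
    \<comment> \<open>The unprovable biconditional is itself the index of a world; agreement of
      \<alpha> and \<beta> there would put it into the theory chosen to omit it.\<close>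
    let ?T = "lindenbaum (\<alpha> \<^bold>\<leftrightarrow> \<beta>)"
    note sat = saturated_lindenbaum[OF nt]
    have "\<alpha> \<in> ?T \<longleftrightarrow> \<beta> \<in> ?T"
      using eq nt truth_set_iff by blast
    then have "(\<alpha> \<^bold>\<leftrightarrow> \<beta>) \<in> ?T"
      by (simp add: saturated_And[OF sat] saturated_Imp[OF sat])
    then show False
      using sat unfolding saturated_def by blast
  qed
next
  assume th: "RmbC_theorem (\<alpha> \<^bold>\<leftrightarrow> \<beta>)"
  have "\<alpha> \<in> lindenbaum \<psi> \<longleftrightarrow> \<beta> \<in> lindenbaum \<psi>" if "\<not> RmbC_theorem \<psi>" for \<psi>
  proof -
    note sat = saturated_lindenbaum[OF that]
    have "(\<alpha> \<^bold>\<leftrightarrow> \<beta>) \<in> lindenbaum \<psi>"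
      using th saturated_is_theory[OF sat] unfolding is_theory_def by blast
    then show ?thesis
      by (auto simp: saturated_And[OF sat] saturated_Imp[OF sat])
  qed
  then show "truth_set g \<alpha> = truth_set g \<beta>"
    unfolding truth_set_def by blast
qed

lemma S_neg_canonical_model:
  "S_neg (canonical_model g) (truth_set g \<alpha>) = truth_set g (\<^bold>\<not> \<alpha>)"
proof -
  \<comment> \<open>Read through \<open>truth_set_eq_iff\<close>, the rule for negation says that
    equal truth sets have negations with equal truth sets, so the union collapses.\<close>
  have "truth_set g (\<^bold>\<not> \<beta>) = truth_set g (\<^bold>\<not> \<alpha>)" if "truth_set g \<alpha> = truth_set g \<beta>" for \<beta>
    using theorem_R_neg[of \<alpha> \<beta>] that unfolding truth_set_eq_iff[symmetric] by simp
  then have "\<Union>{truth_set g (\<^bold>\<not> \<beta>) | \<beta>. truth_set g \<alpha> = truth_set g \<beta>} = truth_set g (\<^bold>\<not> \<alpha>)"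
    by blast
  then show ?thesis
    unfolding canonical_model_def nframe.simps .
qed

lemma S_circ_canonical_model:
  "S_circ (canonical_model g) (truth_set g \<alpha>) = truth_set g (\<^bold>\<circ> \<alpha>)"
proof -
  have "truth_set g (\<^bold>\<circ> \<beta>) = truth_set g (\<^bold>\<circ> \<alpha>)" if "truth_set g \<alpha> = truth_set g \<beta>" for \<beta>
    using theorem_R_circ[of \<alpha> \<beta>] that unfolding truth_set_eq_iff[symmetric] by simp
  then have "\<Union>{truth_set g (\<^bold>\<circ> \<beta>) | \<beta>. truth_set g \<alpha> = truth_set g \<beta>} = truth_set g (\<^bold>\<circ> \<alpha>)"
    by blast
  then show ?thesis
    unfolding canonical_model_def nframe.simps .
qed

text \<open>Every world is the image of a non-theorem, so comparing sets of worlds reduces to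
  membership in the chosen theories.\<close>

lemma truth_set_eqI:
  assumes "U \<subseteq> worlds (canonical_model g)"
    and "\<And>\<psi>. \<not> RmbC_theorem \<psi> \<Longrightarrow> g \<psi> \<in> U \<longleftrightarrow> \<alpha> \<in> lindenbaum \<psi>"
  shows "U = truth_set g \<alpha>"
  using assms by (fastforce simp: truth_set_def canonical_model_def)

lemma mem_worlds_canonical_model: "g \<psi> \<in> worlds (canonical_model g) \<longleftrightarrow> \<not> RmbC_theorem \<psi>"
  using inj by (auto simp: canonical_model_def inj_def)

lemma truth_lemma: "den (canonical_model g) \<alpha> = truth_set g \<alpha>"
proof (induction \<alpha>)
  case (Var p)
  then show ?case
    by (simp add: canonical_model_def)
next
  case (And \<alpha> \<beta>)
  then show ?case
    by (intro truth_set_eqI)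
      (auto simp: truth_set_iff saturated_And[OF saturated_lindenbaum]
        dest: truth_set_subset_worlds[THEN subsetD])
next
  case (Or \<alpha> \<beta>)
  then show ?case
    by (intro truth_set_eqI)
      (auto simp: truth_set_iff saturated_Or[OF saturated_lindenbaum]
        dest: truth_set_subset_worlds[THEN subsetD])
next
  case (Imp \<alpha> \<beta>)
  then show ?case
    by (intro truth_set_eqI)
      (auto simp: truth_set_iff mem_worlds_canonical_model saturated_Imp[OF saturated_lindenbaum]
        dest: truth_set_subset_worlds[THEN subsetD])
next
  \<comment> \<open>The denotation is the complement of the truth set of \<alpha> joined with the
    truth set of the negation; by Ax10 the latter already contains the former.\<close>
  case (Neg \<alpha>)
  then show ?case
    by (intro truth_set_eqI)
      (auto simp: truth_set_iff mem_worlds_canonical_model S_neg_canonical_model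
        dest: saturated_Neg[OF saturated_lindenbaum] truth_set_subset_worlds[THEN subsetD])
next
  \<comment> \<open>By bc1 no world satisfying \<circ>\<alpha> satisfies both \<alpha> and its
    negation, so removing those worlds changes nothing.\<close>
  case (Circ \<alpha>)
  then show ?case
    by (intro truth_set_eqI)
      (auto simp: truth_set_iff mem_worlds_canonical_model S_neg_canonical_model
        S_circ_canonical_model dest: saturated_Circ[OF saturated_lindenbaum] truth_set_subset_worlds[THEN subsetD])
qed

end

section \<open>Transfer to an arbitrary infinite type, and completeness\<close>

instance fm :: countable
  by countable_datatype

lemma ex_inj_fm_infinite: "\<exists>g :: fm \<Rightarrow> 'w :: infinite. inj g"
proof -
  obtain h :: "nat \<Rightarrow> 'w" where "inj h"
    using infinite_countable_subset[OF infinite_UNIV] by blast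
  then have "inj (h \<circ> to_nat :: fm \<Rightarrow> 'w)"
    by (intro inj_compose) simp_all
  then show ?thesis
    by blast
qed

lemma NM_valid_imp_theorem:
  assumes "NM_valid TYPE('w :: infinite) \<phi>"
  shows "RmbC_theorem \<phi>"
proof (rule ccontr)
  assume nt: "\<not> RmbC_theorem \<phi>"
  obtain g :: "fm \<Rightarrow> 'w" where inj: "inj g"
    using ex_inj_fm_infinite by blast
  \<comment> \<open>Validity makes \<phi> true at every world, in particular at
    \<open>g \<phi>\<close>, whose theory omits \<phi>.\<close>
  have "truth_set g \<phi> = worlds (canonical_model g)"
    using assms nmodel_canonical_model[OF nt] truth_lemma[OF inj]
    unfolding NM_valid_def by blast
  then have "\<phi> \<in> lindenbaum \<phi>"
    using nt truth_set_iff[OF inj] mem_worlds_canonical_model[OF inj] by blast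
  then show False
    using saturated_lindenbaum[OF nt] unfolding saturated_def by blast
qed

text \<open>Both consequence relations reduce in the same way to single formulas, so the same list
  of premises serves on the syntactic side.\<close>

theorem theorem5p7:
  fixes \<Gamma> :: "fm set" and \<phi> :: fm
  assumes "NM_entails TYPE('w :: infinite) \<Gamma> \<phi>"
  shows "RmbC_derives \<Gamma> \<phi>"
  using assms NM_valid_imp_theorem unfolding NM_entails_def RmbC_derives_def by blast

end
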